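(* There exist an even $p\in\mathbb{N}$ and a probability measure $\mu$ on $\partial\mathbb{D}$ whose Verblunsky coefficients are periodic with period $p$ such that $\mu$ has a singular point; that is, for some $s\in\{0,\ldots,p-1\}$ and some $k\in\{1,2,\ldots\}$ there is a point $e^{i\theta}$ in a band of $\mathrm{supp}(\mu)$ at which $j_s$ vanishes to order $k$.
   Context: $\mathbb{D}=\{z\in\mathbb{C}:|z|<1\}$. A sequence $\{\alpha_n\}_{n\ge0}\subset\mathbb{D}$ is the sequence of Verblunsky coefficients of a unique probability measure $\mu$ on $\partial\mathbb{D}$ with infinite support; its monic orthogonal polynomials satisfy $\Phi_0=1$, $\Phi_{n+1}(z)=z\Phi_n(z)-\bar\alpha_n\Phi_n^*(z)$, where for a polynomial $Q_n$ with index $n$, $Q_n^*(z)=z^n\overline{Q_n(1/\bar z)}$. The second kind polynomials $\Psi_n$ are obtained from the same recursion with $\alpha_n$ replaced by $-\alpha_n$ and $\Psi_0=1$. Put $\varphi_n=\Phi_n/\prod_{j=0}^{n-1}\sqrt{1-|\alpha_j|^2}$ and $\psi_n=\Psi_n/\prod_{j=0}^{n-1}\sqrt{1-|\alpha_j|^2}$. Suppose $\alpha_{n+p}=\alpha_n$ for all $n$, with $p$ even. Put $\Delta(z)=\dfrac{\varphi_p(z)+\varphi_p^*(z)+\psi_p(z)+\psi_p^*(z)}{2z^{p/2}}$ and $\eta(z;\sigma)=\sigma(\varphi_p(z)-\varphi_p^*(z))-\psi_p(z)-\psi_p^*(z)$. The bands of $\mathrm{supp}(\mu)$ are the disjoint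 closed arcs whose union is $\{e^{i\theta}:|\Delta(e^{i\theta})|\le 2\}$. For $z$ outside the bands let $\Gamma_+(z)=\frac{\Delta(z)}{2}+\sqrt{\frac{\Delta(z)^2}{4}-1}$, with the branch of the square root such that $|\Gamma_+(z)|>1$, and define (with the same branch) $$j_0(z)=\frac{\Gamma_+(z)}{2\sqrt{\Delta(z)^2/4-1}}+\frac{\eta(z;1)}{4z^{p/2}\sqrt{\Delta(z)^2/4-1}},\qquad \ell_0(z)=\frac{\Gamma_+(z)}{2\sqrt{\Delta(z)^2/4-1}}+\frac{\eta(z;-1)}{4z^{p/2}\sqrt{\Delta(z)^2/4-1}},$$ $$j_s(z)=\frac{(\varphi_s(z)+\psi_s(z))j_0(z)+(\varphi_s(z)-\psi_s(z))\ell_0(z)}{2},\qquad s\in\{1,\ldots,p-1\}.$$ (Equivalently $j_s(z)=\lim_{k\to\infty}z^{-kp/2}\varphi_{kp+s}(z)/\Gamma_+(z)^k$.) For $e^{i\theta}$ in a band, $j_s(e^{i\theta}):=\lim_{r\to1^-}j_s(re^{i\theta})$, and vanishing to order $k$ refers to the function $j_s$ on $\mathbb{D}$ extended to the band in this way: $\lim_{r\to 1^-} j_s(re^{i\theta})/(1-r)^k$ exists, is finite and is nonzero. A singular point of order $k$ is a point in the bands where some $j_s$ vanishes to order $k$. *)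

theory Defs
  imports "HOL-Probability.Probability" "HOL-Computational_Algebra.Polynomial"
begin

definition unit_circle :: "complex set" where
  "unit_circle = sphere 0 1"

definition circle_prob :: "complex measure \<Rightarrow> bool" where
  "circle_prob M \<longleftrightarrow> prob_space M \<and> sets M = sets (restrict_space borel unit_circle)"

definition msupport :: "complex measure \<Rightarrow> complex set" where
  "msupport M = {z \<in> unit_circle. \<forall>U. open U \<and> z \<in> U \<longrightarrow> emeasure M (U \<inter> unit_circle) > 0}"

text \<open>The reversal with index \<open>n\<close>, written on coefficients so that it is again a polynomial
  (in particular at the origin); see \<open>poly_rev_poly\<close> below.\<close>

definition rev_poly :: "nat \<Rightarrow> complex poly \<Rightarrow> complex poly" where
  "rev_poly n Q = (\<Sum>k\<le>n. monom (cnj (coeff Q (n - k))) k)"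

lemma poly_rev_poly:
  assumes "degree Q \<le> n" and "z \<noteq> 0"
  shows "poly (rev_poly n Q) z = z ^ n * cnj (poly Q (1 / cnj z))"
proof -
  have "poly (rev_poly n Q) z = (\<Sum>k\<le>n. cnj (coeff Q (n - k)) * z ^ k)"
    by (simp add: rev_poly_def poly_sum poly_monom)
  also have "\<dots> = (\<Sum>i\<le>n. cnj (coeff Q i) * z ^ (n - i))"
    by (rule sum.reindex_bij_witness[of _ "\<lambda>i. n - i" "\<lambda>i. n - i"]) auto
  also have "\<dots> = (\<Sum>i\<le>n. z ^ n * cnj (coeff Q i * (1 / cnj z) ^ i))"
    using assms(2) by (intro sum.cong) (auto simp: power_diff field_simps)
  also have "\<dots> = z ^ n * cnj (\<Sum>i\<le>n. coeff Q i * (1 / cnj z) ^ i)"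
    by (simp add: sum_distrib_left)
  also have "(\<Sum>i\<le>n. coeff Q i * (1 / cnj z) ^ i) = poly Q (1 / cnj z)"
    unfolding poly_altdef using assms(1)
    by (intro sum.mono_neutral_right) (auto simp: coeff_eq_0)
  finally show ?thesis .
qed

primrec Phi :: "(nat \<Rightarrow> complex) \<Rightarrow> nat \<Rightarrow> complex poly" where
  "Phi \<alpha> 0 = 1"
| "Phi \<alpha> (Suc n) = monom 1 1 * Phi \<alpha> n - smult (cnj (\<alpha> n)) (rev_poly n (Phi \<alpha> n))"

definition Psi :: "(nat \<Rightarrow> complex) \<Rightarrow> nat \<Rightarrow> complex poly" where
  "Psi \<alpha> = Phi (\<lambda>n. - \<alpha> n)"

definition rho_prod :: "(nat \<Rightarrow> complex) \<Rightarrow> nat \<Rightarrow> real" where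
  "rho_prod \<alpha> n = (\<Prod>j<n. sqrt (1 - (cmod (\<alpha> j))\<^sup>2))"

definition phi :: "(nat \<Rightarrow> complex) \<Rightarrow> nat \<Rightarrow> complex poly" where
  "phi \<alpha> n = smult (1 / complex_of_real (rho_prod \<alpha> n)) (Phi \<alpha> n)"

definition psi :: "(nat \<Rightarrow> complex) \<Rightarrow> nat \<Rightarrow> complex poly" where
  "psi \<alpha> n = smult (1 / complex_of_real (rho_prod \<alpha> n)) (Psi \<alpha> n)"

definition phi_star :: "(nat \<Rightarrow> complex) \<Rightarrow> nat \<Rightarrow> complex poly" where
  "phi_star \<alpha> n = rev_poly n (phi \<alpha> n)"

definition psi_star :: "(nat \<Rightarrow> complex) \<Rightarrow> nat \<Rightarrow> complex poly" where
  "psi_star \<alpha> n = rev_poly n (psi \<alpha> n)"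

definition monic_orthogonal :: "complex measure \<Rightarrow> nat \<Rightarrow> complex poly \<Rightarrow> bool" where
  "monic_orthogonal M n P \<longleftrightarrow>
     degree P = n \<and> lead_coeff P = 1 \<and> (\<forall>m<n. (LINT z|M. cnj (z ^ m) * poly P z) = 0)"

text \<open>Since the support is infinite, the monic orthogonal polynomials of \<open>M\<close> are unique, so the
  last conjunct says that they obey the Szego recursion with coefficients \<open>\<alpha>\<close>.\<close>

definition verblunsky_coeffs :: "complex measure \<Rightarrow> (nat \<Rightarrow> complex) \<Rightarrow> bool" where
  "verblunsky_coeffs M \<alpha> \<longleftrightarrow>
     circle_prob M \<and> infinite (msupport M) \<and> (\<forall>n. \<alpha> n \<in> ball 0 1) \<and>
     (\<forall>n. monic_orthogonal M n (Phi \<alpha> n))"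

text \<open>From here on \<open>p\<close> is the (even, positive) period, so that \<open>p div 2\<close> is exact.\<close>

definition Discr :: "(nat \<Rightarrow> complex) \<Rightarrow> nat \<Rightarrow> complex \<Rightarrow> complex" where
  "Discr \<alpha> p z =
     (poly (phi \<alpha> p) z + poly (phi_star \<alpha> p) z + poly (psi \<alpha> p) z + poly (psi_star \<alpha> p) z)
       / (2 * z ^ (p div 2))"

definition eta :: "(nat \<Rightarrow> complex) \<Rightarrow> nat \<Rightarrow> complex \<Rightarrow> complex \<Rightarrow> complex" where
  "eta \<alpha> p z \<sigma> =
     \<sigma> * (poly (phi \<alpha> p) z - poly (phi_star \<alpha> p) z) - poly (psi \<alpha> p) z - poly (psi_star \<alpha> p) z"

definition bands :: "(nat \<Rightarrow> complex) \<Rightarrow> nat \<Rightarrow> complex set set" where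
  "bands \<alpha> p = components {z \<in> unit_circle. cmod (Discr \<alpha> p z) \<le> 2}"

text \<open>The branch of the square root; it is unique whenever \<open>Discr \<alpha> p z\<close> is not in the real
  interval from \<open>-2\<close> to \<open>2\<close>, since the two candidates for \<open>Gamma_plus\<close> have product 1.\<close>

definition disc_sqrt :: "(nat \<Rightarrow> complex) \<Rightarrow> nat \<Rightarrow> complex \<Rightarrow> complex" where
  "disc_sqrt \<alpha> p z =
     (THE w. w\<^sup>2 = (Discr \<alpha> p z)\<^sup>2 / 4 - 1 \<and> cmod (Discr \<alpha> p z / 2 + w) > 1)"

definition Gamma_plus :: "(nat \<Rightarrow> complex) \<Rightarrow> nat \<Rightarrow> complex \<Rightarrow> complex" where
  "Gamma_plus \<alpha> p z = Discr \<alpha> p z / 2 + disc_sqrt \<alpha> p z"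

definition j0 :: "(nat \<Rightarrow> complex) \<Rightarrow> nat \<Rightarrow> complex \<Rightarrow> complex" where
  "j0 \<alpha> p z = Gamma_plus \<alpha> p z / (2 * disc_sqrt \<alpha> p z)
     + eta \<alpha> p z 1 / (4 * z ^ (p div 2) * disc_sqrt \<alpha> p z)"

definition l0 :: "(nat \<Rightarrow> complex) \<Rightarrow> nat \<Rightarrow> complex \<Rightarrow> complex" where
  "l0 \<alpha> p z = Gamma_plus \<alpha> p z / (2 * disc_sqrt \<alpha> p z)
     + eta \<alpha> p z (- 1) / (4 * z ^ (p div 2) * disc_sqrt \<alpha> p z)"

definition jfun :: "(nat \<Rightarrow> complex) \<Rightarrow> nat \<Rightarrow> nat \<Rightarrow> complex \<Rightarrow> complex" where
  "jfun \<alpha> p s z =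
     ((poly (phi \<alpha> s) z + poly (psi \<alpha> s) z) * j0 \<alpha> p z
       + (poly (phi \<alpha> s) z - poly (psi \<alpha> s) z) * l0 \<alpha> p z) / 2"

lemma jfun_0: "jfun \<alpha> p 0 z = j0 \<alpha> p z"
  by (simp add: jfun_def phi_def psi_def Psi_def rho_prod_def)

definition vanishes_to_order :: "(complex \<Rightarrow> complex) \<Rightarrow> complex \<Rightarrow> nat \<Rightarrow> bool" where
  "vanishes_to_order f z k \<longleftrightarrow>
     (\<exists>L. L \<noteq> 0 \<and>
       ((\<lambda>r. f (complex_of_real r * z) / complex_of_real ((1 - r) ^ k)) \<longlongrightarrow> L) (at_left 1))"

definition singular_point :: "(nat \<Rightarrow> complex) \<Rightarrow> nat \<Rightarrow> nat \<Rightarrow> complex \<Rightarrow> bool" where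
  "singular_point \<alpha> p k z \<longleftrightarrow>
     (\<exists>B \<in> bands \<alpha> p. z \<in> B) \<and> (\<exists>s<p. vanishes_to_order (jfun \<alpha> p s) z k)"

end

theory Submission
  imports Defs "HOL-Complex_Analysis.Complex_Analysis"
begin

text \<open>The place to look for a singular point is a closed gap.  There the transfer matrix over one period,
  normalised by \<open>z\<^sup>-\<^sup>p\<^sup>/\<^sup>2\<close>, is plus or minus the identity, and the limits of its two eigenvectors are
  determined by its derivative.  The function \<open>j\<^sub>0\<close> is the first component of the projection of
  \<open>(\<phi>\<^sub>0, \<phi>\<^sub>0\<^sup>*) = (1, 1)\<close> to the eigenvector of the eigenvalue \<open>\<Gamma>\<^sub>+\<close>; it vanishes at the closed gap when
  this eigenvector tends to \<open>(0, 1)\<close>, that is, when the derivative is a diagonal matrix (with the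
  sign pattern of the free case).

  Write \<open>A(a)\<close> for the matrix of one step at \<open>z = 1\<close>.  For real \<open>a\<close> one has
  \<open>A(a) A(-a) = 1\<close>, so the coefficients \<open>a, -a, -a, a\<close> give the identity at \<open>z = 1\<close>.  The normalised derivative
  there is half the sum of the four conjugates of \<open>diag(1, -1)\<close> by the partial products
  \<open>1, A(a), 1, A(-a)\<close>.  The off-diagonal entries contributed by \<open>A(a)\<close> and by \<open>A(-a)\<close> are
  opposite, so the sum is diagonal and \<open>j\<^sub>0\<close> has a zero at \<open>1\<close>.  For \<open>a = 3/5\<close> everything is
  explicit: lemma \<open>jfun_sing_alpha\<close> displays the zero and lemma \<open>vanishes_sing_alpha\<close> records that it is
  simple, with leading coefficient \<open>-15/32\<close>.

  What remains is that these numbers are the Verblunsky coefficients of some measure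
  (\<open>Verblunsky_existence\<close>, for arbitrary coefficients in the open unit disc).  The Bernstein-Szego measures with
  density \<open>1 / \<bar>\<phi>\<^sub>n\<bar>\<^sup>2\<close> have the right orthogonality relations up to index \<open>n\<close>: at \<open>n\<close> by the mean value
  property, since \<open>\<Phi>\<^sub>n\<^sup>*\<close> has no zeros in the closed disc, and below \<open>n\<close> by the inverse recursion.
  A weak limit, which exists by Helly's selection theorem, then has all of them.\<close>

section \<open>The Szego recursion\<close>

lemma coeff_rev_poly: "coeff (rev_poly n Q) k = (if k \<le> n then cnj (coeff Q (n - k)) else 0)"
  by (auto simp: rev_poly_def coeff_sum)

lemma degree_Phi_le: "degree (Phi \<alpha> n) \<le> n"
proof (induction n)
  case (Suc n)
  have "coeff (Phi \<alpha> n) i = 0" if "i > n" for i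
    using Suc that by (simp add: coeff_eq_0)
  thus ?case
    by (intro degree_le) (auto simp: coeff_rev_poly coeff_monom_mult)
qed simp

lemma coeff_Phi_self: "coeff (Phi \<alpha> n) n = 1"
  by (induction n) (auto simp: coeff_rev_poly coeff_monom_mult)

lemma degree_Phi: "degree (Phi \<alpha> n) = n"
  using degree_Phi_le[of \<alpha> n] le_degree[of "Phi \<alpha> n" n] coeff_Phi_self[of \<alpha> n] by auto

definition Phi_star :: "(nat \<Rightarrow> complex) \<Rightarrow> nat \<Rightarrow> complex poly" where
  "Phi_star \<alpha> n = rev_poly n (Phi \<alpha> n)"

lemma Phi_star_Suc:
  "Phi_star \<alpha> (Suc n) = Phi_star \<alpha> n - smult (\<alpha> n) (monom 1 1 * Phi \<alpha> n)"
proof (rule poly_eqI)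
  fix k
  have "coeff (Phi \<alpha> n) i = 0" if "i > n" for i
    using degree_Phi_le[of \<alpha> n] that by (simp add: coeff_eq_0)
  then show "coeff (Phi_star \<alpha> (Suc n)) k
      = coeff (Phi_star \<alpha> n - smult (\<alpha> n) (monom 1 1 * Phi \<alpha> n)) k"
    by (cases k) (auto simp: Phi_star_def coeff_rev_poly coeff_monom_mult Suc_diff_le
        not_less_eq_eq simp flip: Suc_diff_le intro!: arg_cong[where f = cnj] split: nat.splits)
qed

lemma poly_Phi_Suc: "poly (Phi \<alpha> (Suc n)) z = z * poly (Phi \<alpha> n) z - cnj (\<alpha> n) * poly (Phi_star \<alpha> n) z"
  by (simp add: Phi_star_def poly_monom)

lemma poly_Phi_star_Suc: "poly (Phi_star \<alpha> (Suc n)) z = poly (Phi_star \<alpha> n) z - \<alpha> n * z * poly (Phi \<alpha> n) z"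
  by (simp add: Phi_star_Suc poly_monom)

lemma Phi_star_0: "poly (Phi_star \<alpha> n) 0 = 1"
  by (simp add: poly_0_coeff_0 Phi_star_def coeff_rev_poly coeff_Phi_self)

lemma poly_Phi_star_circle:
  assumes "cmod z = 1"
  shows "poly (Phi_star \<alpha> n) z = z ^ n * cnj (poly (Phi \<alpha> n) z)"
proof -
  have "z * cnj z = 1" using assms complex_norm_square[of z] by simp
  moreover from this have "z \<noteq> 0" by auto
  ultimately have "1 / cnj z = z" "z \<noteq> 0" by (auto simp: field_simps)
  then show ?thesis
    using poly_rev_poly[OF degree_Phi_le[of \<alpha> n], of z] by (simp add: Phi_star_def)
qed

text \<open>The matrix of one recursion step preserves the form \<open>\<bar>v\<bar>\<^sup>2 - \<bar>u\<bar>\<^sup>2\<close> up to the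
  factor \<open>1 - \<bar>a\<bar>\<^sup>2\<close>.  This is what keeps the zeros of the reversed polynomials outside the
  closed disc.\<close>

lemma reflection_energy:
  fixes u v a :: complex
  shows "(cmod (v - a * u))\<^sup>2 - (cmod (u - cnj a * v))\<^sup>2 = (1 - (cmod a)\<^sup>2) * ((cmod v)\<^sup>2 - (cmod u)\<^sup>2)"
proof -
  have "complex_of_real ((cmod (v - a * u))\<^sup>2 - (cmod (u - cnj a * v))\<^sup>2) =
      of_real ((1 - (cmod a)\<^sup>2) * ((cmod v)\<^sup>2 - (cmod u)\<^sup>2))"
    by (simp add: complex_norm_square algebra_simps del: of_real_power)
  thus ?thesis using of_real_eq_iff by blast
qed

text \<open>Both claims feed each other in the induction: the step for the inequality is the identity
  above, and the inequality together with \<open>\<bar>\<alpha> n\<bar> < 1\<close> excludes a zero at the next index.\<close>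

lemma Phi_star_dominates:
  assumes a: "\<And>n. cmod (\<alpha> n) < 1" and z: "cmod z \<le> 1"
  shows "cmod (poly (Phi \<alpha> n) z) \<le> cmod (poly (Phi_star \<alpha> n) z) \<and> poly (Phi_star \<alpha> n) z \<noteq> 0"
proof (induction n)
  case 0
  then show ?case by (simp add: Phi_star_def rev_poly_def)
next
  case (Suc n)
  define u v where "u = z * poly (Phi \<alpha> n) z" and "v = poly (Phi_star \<alpha> n) z"
  have uv: "cmod u \<le> cmod v" "v \<noteq> 0"
    using Suc mult_mono[OF z, of "cmod (poly (Phi \<alpha> n) z)" "cmod v"]
    by (auto simp: u_def v_def norm_mult)
  have "(cmod (\<alpha> n))\<^sup>2 \<le> 1" using a[of n] by (simp add: power_le_one)
  moreover have "(cmod u)\<^sup>2 \<le> (cmod v)\<^sup>2" using uv(1) by (rule power_mono) simp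
  ultimately have "0 \<le> (1 - (cmod (\<alpha> n))\<^sup>2) * ((cmod v)\<^sup>2 - (cmod u)\<^sup>2)"
    by (intro mult_nonneg_nonneg) linarith+
  then have "(cmod (u - cnj (\<alpha> n) * v))\<^sup>2 \<le> (cmod (v - \<alpha> n * u))\<^sup>2"
    unfolding reflection_energy[symmetric] by linarith
  then have le: "cmod (u - cnj (\<alpha> n) * v) \<le> cmod (v - \<alpha> n * u)"
    by (rule power2_le_imp_le) (rule norm_ge_zero)
  have "cmod (\<alpha> n * u) \<le> cmod (\<alpha> n) * cmod v"
    using uv by (simp add: norm_mult mult_left_mono)
  also have "\<dots> < cmod v" using a[of n] uv by simp
  finally have "v - \<alpha> n * u \<noteq> 0" by auto
  with le show ?case by (simp only: poly_Phi_Suc poly_Phi_star_Suc u_def v_def mult.assoc) simp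
qed

section \<open>Bernstein-Szego measures\<close>

text \<open>The circle is parametrised by the unit interval, so that normalised arc length becomes Lebesgue
  measure and a compactness theorem for measures on the line applies.\<close>

definition circ :: "real \<Rightarrow> complex" where
  "circ t = cis (2 * pi * t)"

lemma has_integral_circ_mean:
  assumes "f holomorphic_on S" "cball 0 1 \<subseteq> S"
  shows "((\<lambda>t. f (circ t)) has_integral f 0) {0..1}"
proof -
  have "((\<lambda>u. f u / (u - 0)) has_contour_integral (2 * of_real pi * \<i> * f 0)) (circlepath 0 1)"
    using assms by (intro Cauchy_integral_circlepath_simple) (auto intro: holomorphic_on_subset)
  then have "((\<lambda>t. f (circ t) / circ t * (2 * of_real pi * \<i> * circ t)) has_integral (2 * of_real pi * \<i> * f 0)) {0..1}"
    unfolding has_contour_integral_def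
  proof (rule has_integral_eq[rotated])
    fix t :: real assume "t \<in> {0..1}"
    then have "vector_derivative (circlepath 0 1) (at t within {0..1}) = 2 * of_real pi * \<i> * circ t"
      by (simp add: vector_derivative_circlepath01 circ_def cis_conv_exp mult_ac)
    moreover have "circlepath 0 1 t = circ t"
      by (simp add: circlepath circ_def cis_conv_exp mult_ac)
    ultimately show "f (circlepath 0 1 t) / (circlepath 0 1 t - 0) * vector_derivative (circlepath 0 1) (at t within {0..1})
        = f (circ t) / circ t * (2 * of_real pi * \<i> * circ t)" by simp
  qed
  then have "((\<lambda>t. (2 * of_real pi * \<i>) * f (circ t)) has_integral (2 * of_real pi * \<i> * f 0)) {0..1}"
    by (simp add: circ_def mult_ac)
  from has_integral_mult_right[OF this, of "1 / (2 * of_real pi * \<i>)"]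
  show ?thesis by simp
qed

lemma norm_circ [simp]: "cmod (circ t) = 1" by (simp add: circ_def)

lemma isCont_circ: "isCont circ t"
  unfolding circ_def cis_conv_exp by (intro continuous_intros)

lemma measurable_circ [measurable]: "circ \<in> borel_measurable borel"
  by (intro borel_measurable_continuous_onI continuous_at_imp_continuous_on ballI isCont_circ)

definition rho_sq :: "(nat \<Rightarrow> complex) \<Rightarrow> nat \<Rightarrow> real" where
  "rho_sq \<alpha> n = (\<Prod>j<n. 1 - (cmod (\<alpha> j))\<^sup>2)"

lemma one_minus_cmod_sq_pos: "cmod a < 1 \<Longrightarrow> 0 < 1 - (cmod a)\<^sup>2"
  by (simp add: power_less_one_iff)

lemma rho_sq_pos: "(\<And>n. cmod (\<alpha> n) < 1) \<Longrightarrow> 0 < rho_sq \<alpha> n"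
  unfolding rho_sq_def by (intro prod_pos ballI one_minus_cmod_sq_pos)

text \<open>The value at \<open>m = k\<close> is carried along with the orthogonality relations: for \<open>k = 0\<close> it says that
  the measure has total mass one, and its being nonzero for all \<open>k\<close> is what forces the support to
  be infinite.\<close>

definition orthogonal_at :: "real measure \<Rightarrow> (nat \<Rightarrow> complex) \<Rightarrow> nat \<Rightarrow> bool" where
  "orthogonal_at N \<alpha> k \<longleftrightarrow>
     (\<forall>m\<le>k. (LINT t|N. cnj (circ t ^ m) * poly (Phi \<alpha> k) (circ t))
            = (if m = k then of_real (rho_sq \<alpha> k) else 0))"

lemma bounded_circ:
  fixes f :: "complex \<Rightarrow> complex"
  assumes "continuous_on UNIV f"
  shows "\<exists>B. \<forall>t. norm (f (circ t)) \<le> B"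
proof -
  have "compact (f ` sphere 0 1)"
    by (intro compact_continuous_image continuous_on_subset[OF assms]) auto
  then have "bounded (f ` sphere 0 1)" by (rule compact_imp_bounded)
  then show ?thesis by (force simp: bounded_iff)
qed

lemma integrable_circ:
  fixes f :: "complex \<Rightarrow> complex"
  assumes "finite_measure N" "sets N = sets borel" "continuous_on UNIV f"
  shows "integrable N (\<lambda>t. f (circ t))"
proof -
  interpret finite_measure N by fact
  obtain B where B: "\<And>t. norm (f (circ t)) \<le> B" using bounded_circ[OF assms(3)] by blast
  have "(\<lambda>t. f (circ t)) \<in> borel_measurable borel"
    using borel_measurable_continuous_onI[OF assms(3)] by measurable
  then have "(\<lambda>t. f (circ t)) \<in> borel_measurable N"
    using measurable_cong_sets[OF assms(2) refl] by blast
  then show ?thesis by (intro integrable_const_bound[where B = B] AE_I2 B) auto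
qed

lemma integrable_circ_poly:
  assumes "finite_measure N" "sets N = sets borel"
  shows "integrable N (\<lambda>t. cnj (circ t ^ m) * poly q (circ t))"
  by (rule integrable_circ[OF assms, of "\<lambda>z. cnj (z ^ m) * poly q z"]) (intro continuous_intros)

lemma circ_cnj_mult: "circ t * cnj (circ t) = 1"
  using complex_norm_square[of "circ t"] by simp

text \<open>On the circle reversal is complex conjugation followed by multiplication by \<open>z\<^sup>k\<close>; hence the
  moments of the reversed polynomial are the conjugates of those of \<open>Phi\<close>, in opposite order.\<close>

lemma reverse_moment:
  assumes "orthogonal_at N \<alpha> k" "m \<le> k"
  shows "(LINT t|N. cnj (circ t ^ m) * poly (Phi_star \<alpha> k) (circ t)) = (if m = 0 then of_real (rho_sq \<alpha> k) else 0)"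
proof -
  have "cnj (circ t ^ m) * poly (Phi_star \<alpha> k) (circ t) = cnj (cnj (circ t ^ (k - m)) * poly (Phi \<alpha> k) (circ t))" for t
  proof -
    have "circ t ^ k = circ t ^ m * circ t ^ (k - m)" using assms(2) by (simp flip: power_add)
    moreover have "cnj (circ t) ^ m * circ t ^ m = 1"
      using circ_cnj_mult[of t] by (simp add: mult.commute flip: power_mult_distrib)
    ultimately show ?thesis by (simp add: poly_Phi_star_circle)
  qed
  then show ?thesis using assms
    by (auto simp: orthogonal_at_def simp del: complex_cnj_mult complex_cnj_power)
qed

text \<open>The recursion can be run backwards: \<open>(1 - \<bar>\<alpha> k\<bar>\<^sup>2) z \<Phi>\<^sub>k = \<Phi>\<^sub>k\<^sub>+\<^sub>1 + cnj (\<alpha> k) \<Phi>\<^sub>k\<^sub>+\<^sub>1\<^sup>*\<close>.  So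
  orthogonality at one index implies orthogonality at all smaller ones.\<close>

lemma orthogonal_at_down:
  assumes a: "\<And>n. cmod (\<alpha> n) < 1" and N: "finite_measure N" "sets N = sets borel"
    and orth: "orthogonal_at N \<alpha> (Suc k)"
  shows "orthogonal_at N \<alpha> k"
  unfolding orthogonal_at_def
proof (intro allI impI)
  fix m assume m: "m \<le> k"
  define c where "c = 1 - (cmod (\<alpha> k))\<^sup>2"
  have c: "c > 0" using a[of k] unfolding c_def by (rule one_minus_cmod_sq_pos)
  have c': "complex_of_real c = 1 - cnj (\<alpha> k) * \<alpha> k"
    by (simp add: c_def complex_norm_square mult.commute del: of_real_power)
  have "of_real c * (cnj (circ t ^ m) * poly (Phi \<alpha> k) (circ t))
      = cnj (circ t ^ Suc m) * poly (Phi \<alpha> (Suc k)) (circ t)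
      + cnj (\<alpha> k) * (cnj (circ t ^ Suc m) * poly (Phi_star \<alpha> (Suc k)) (circ t))" for t
  proof -
    have "of_real c * (cnj (circ t ^ m) * poly (Phi \<alpha> k) (circ t))
        = (circ t * cnj (circ t)) * of_real c * (cnj (circ t ^ m) * poly (Phi \<alpha> k) (circ t))"
      unfolding circ_cnj_mult by simp
    also have "\<dots> = cnj (circ t ^ Suc m) * poly (Phi \<alpha> (Suc k)) (circ t)
      + cnj (\<alpha> k) * (cnj (circ t ^ Suc m) * poly (Phi_star \<alpha> (Suc k)) (circ t))"
      unfolding poly_Phi_Suc poly_Phi_star_Suc c' by (simp add: algebra_simps)
    finally show ?thesis .
  qed
  note inverse_recursion = this
  have e1: "(LINT t|N. cnj (circ t ^ Suc m) * poly (Phi \<alpha> (Suc k)) (circ t))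
      = (if Suc m = Suc k then of_real (rho_sq \<alpha> (Suc k)) else 0)"
    using orth m unfolding orthogonal_at_def by (meson Suc_le_mono)
  have e2: "(LINT t|N. cnj (circ t ^ Suc m) * poly (Phi_star \<alpha> (Suc k)) (circ t)) = 0"
    using reverse_moment[OF orth, of "Suc m"] m by (simp only: Suc_le_mono nat.distinct if_False simp_thms)
  from inverse_recursion have "of_real c * (LINT t|N. cnj (circ t ^ m) * poly (Phi \<alpha> k) (circ t))
      = (LINT t|N. cnj (circ t ^ Suc m) * poly (Phi \<alpha> (Suc k)) (circ t)
      + cnj (\<alpha> k) * (cnj (circ t ^ Suc m) * poly (Phi_star \<alpha> (Suc k)) (circ t)))"
    by (simp only: integral_mult_right_zero [symmetric])
  also have "\<dots> = (LINT t|N. cnj (circ t ^ Suc m) * poly (Phi \<alpha> (Suc k)) (circ t))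
      + cnj (\<alpha> k) * (LINT t|N. cnj (circ t ^ Suc m) * poly (Phi_star \<alpha> (Suc k)) (circ t))"
    unfolding integral_mult_right_zero[symmetric]
    by (intro Bochner_Integration.integral_add integrable_mult_right integrable_circ_poly[OF N])
  also have "\<dots> = (if m = k then of_real (rho_sq \<alpha> (Suc k)) else 0)"
    unfolding e1 e2 by simp
  also have "\<dots> = of_real c * (if m = k then of_real (rho_sq \<alpha> k) else 0)"
    by (simp add: rho_sq_def c_def mult.commute)
  finally show "(LINT t|N. cnj (circ t ^ m) * poly (Phi \<alpha> k) (circ t)) = (if m = k then of_real (rho_sq \<alpha> k) else 0)"
    using c by simp
qed

text \<open>The density \<open>1 / \<bar>\<phi>\<^sub>n\<bar>\<^sup>2\<close>, restricted below to one period of the parametrisation.\<close>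

definition bs_weight :: "(nat \<Rightarrow> complex) \<Rightarrow> nat \<Rightarrow> real \<Rightarrow> real" where
  "bs_weight \<alpha> n t = rho_sq \<alpha> n / (cmod (poly (Phi \<alpha> n) (circ t)))\<^sup>2"

definition bs_measure :: "(nat \<Rightarrow> complex) \<Rightarrow> nat \<Rightarrow> real measure" where
  "bs_measure \<alpha> n = density lborel (\<lambda>t. ennreal (indicator {0..1} t * bs_weight \<alpha> n t))"

context
  fixes \<alpha> :: "nat \<Rightarrow> complex"
  assumes a: "\<And>n. cmod (\<alpha> n) < 1"
begin

lemma Phi_circ_nz: "poly (Phi \<alpha> n) (circ t) \<noteq> 0"
  using Phi_star_dominates[of \<alpha> "circ t" n, OF a] poly_Phi_star_circle[of "circ t" \<alpha> n] by auto

lemma bs_weight_nonneg: "0 \<le> bs_weight \<alpha> n t"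
  using rho_sq_pos[of \<alpha> n, OF a] by (simp add: bs_weight_def)

lemma continuous_bs_weight: "continuous_on S (bs_weight \<alpha> n)"
  unfolding bs_weight_def
  by (intro continuous_at_imp_continuous_on ballI continuous_intros isCont_circ) (simp add: Phi_circ_nz)

lemma bs_density_measurable: "(\<lambda>t. indicator {0..1} t * bs_weight \<alpha> n t) \<in> borel_measurable lborel"
  using borel_measurable_continuous_onI[OF continuous_bs_weight] by measurable

lemma sets_bs_measure [simp]: "sets (bs_measure \<alpha> n) = sets borel"
  by (simp add: bs_measure_def)

lemma finite_bs_measure: "finite_measure (bs_measure \<alpha> n)"
proof (rule finite_measureI)
  have "integrable lborel (\<lambda>t. indicator {0..1} t * bs_weight \<alpha> n t)"
    using borel_integrable_atLeastAtMost'[OF continuous_bs_weight[of _ n], of 0 1]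
    by (simp add: set_integrable_def)
  then have "(\<integral>\<^sup>+t. ennreal (indicator {0..1} t * bs_weight \<alpha> n t) \<partial>lborel) < \<infinity>"
    using bs_weight_nonneg by (subst nn_integral_eq_integral) auto
  then show "emeasure (bs_measure \<alpha> n) (space (bs_measure \<alpha> n)) \<noteq> \<infinity>"
    using bs_density_measurable[of n] by (simp add: bs_measure_def emeasure_density)
qed

lemma integral_bs_measure:
  fixes f :: "complex \<Rightarrow> complex"
  assumes "continuous_on UNIV f"
  shows "(LINT t|bs_measure \<alpha> n. f (circ t)) = integral {0..1} (\<lambda>t. bs_weight \<alpha> n t *\<^sub>R f (circ t))"
proof -
  have c: "continuous_on S (\<lambda>t. bs_weight \<alpha> n t *\<^sub>R f (circ t))" for S
    by (intro continuous_intros continuous_bs_weight continuous_on_compose2[OF assms]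
        continuous_at_imp_continuous_on ballI isCont_circ) auto
  have "(\<lambda>t. f (circ t)) \<in> borel_measurable lborel"
    using borel_measurable_continuous_onI[OF assms] by measurable
  then have "(LINT t|bs_measure \<alpha> n. f (circ t)) = (LINT t:{0..1}|lborel. bs_weight \<alpha> n t *\<^sub>R f (circ t))"
    unfolding bs_measure_def set_lebesgue_integral_def
    using bs_weight_nonneg bs_density_measurable[of n] by (subst integral_density) auto
  also have "\<dots> = integral {0..1} (\<lambda>t. bs_weight \<alpha> n t *\<^sub>R f (circ t))"
    by (intro set_borel_integral_eq_integral borel_integrable_atLeastAtMost' c)
  finally show ?thesis .
qed

text \<open>On the circle the integrand \<open>cnj z\<^sup>m \<Phi>\<^sub>n / \<bar>\<Phi>\<^sub>n\<bar>\<^sup>2\<close> equals \<open>z\<^sup>n\<^sup>-\<^sup>m / \<Phi>\<^sub>n\<^sup>*\<close>, which is holomorphic on the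
  closed disc; its mean is its value at the origin.\<close>

lemma bs_measure_orthogonal_top: "orthogonal_at (bs_measure \<alpha> n) \<alpha> n"
  unfolding orthogonal_at_def
proof (intro allI impI)
  fix m assume m: "m \<le> n"
  define S where "S = {z. poly (Phi_star \<alpha> n) z \<noteq> 0}"
  define f where "f z = of_real (rho_sq \<alpha> n) * z ^ (n - m) / poly (Phi_star \<alpha> n) z" for z
  have "f holomorphic_on S" unfolding f_def S_def by (intro holomorphic_intros) auto
  moreover have "cball 0 1 \<subseteq> S" using Phi_star_dominates[of \<alpha>, OF a] by (auto simp: S_def)
  ultimately have f: "((\<lambda>t. f (circ t)) has_integral f 0) {0..1}" by (rule has_integral_circ_mean)
  have eq: "bs_weight \<alpha> n t *\<^sub>R (cnj (circ t ^ m) * poly (Phi \<alpha> n) (circ t)) = f (circ t)" for t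
  proof -
    define z where "z = circ t"
    define w where "w = poly (Phi \<alpha> n) z"
    have z: "z * cnj z = 1" "z \<noteq> 0" using circ_cnj_mult[of t] by (auto simp: z_def)
    have w: "w \<noteq> 0" using Phi_circ_nz by (simp add: w_def z_def)
    have "z ^ n = z ^ m * z ^ (n - m)" using m by (simp flip: power_add)
    moreover have "z ^ m * cnj z ^ m = 1" using z by (simp flip: power_mult_distrib)
    ultimately have zn: "z ^ n * cnj z ^ m = z ^ (n - m)" by (simp add: mult_ac)
    have "bs_weight \<alpha> n t *\<^sub>R (cnj (z ^ m) * w) = of_real (rho_sq \<alpha> n) * (cnj z ^ m * w) / (w * cnj w)"
      by (simp add: bs_weight_def w_def z_def scaleR_conv_of_real complex_norm_square del: of_real_power)
    also have "\<dots> = of_real (rho_sq \<alpha> n) * (z ^ n * cnj z ^ m) / (z ^ n * cnj w)"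
      using w z by simp
    also have "\<dots> = f z"
      unfolding zn f_def by (simp add: poly_Phi_star_circle z_def w_def)
    finally show ?thesis by (simp add: z_def w_def)
  qed
  have "(LINT t|bs_measure \<alpha> n. cnj (circ t ^ m) * poly (Phi \<alpha> n) (circ t)) = integral {0..1} (\<lambda>t. f (circ t))"
    unfolding eq[symmetric]
    by (rule integral_bs_measure[of "\<lambda>z. cnj (z ^ m) * poly (Phi \<alpha> n) z"]) (intro continuous_intros)
  also have "\<dots> = f 0" using f by (rule integral_unique)
  also have "\<dots> = (if m = n then of_real (rho_sq \<alpha> n) else 0)"
    using m by (simp add: f_def Phi_star_0)
  finally show "(LINT t|bs_measure \<alpha> n. cnj (circ t ^ m) * poly (Phi \<alpha> n) (circ t)) = (if m = n then of_real (rho_sq \<alpha> n) else 0)" .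
qed

lemma bs_measure_orthogonal: "k \<le> n \<Longrightarrow> orthogonal_at (bs_measure \<alpha> n) \<alpha> k"
proof (induction rule: inc_induct)
  case base
  show ?case by (rule bs_measure_orthogonal_top)
next
  case (step k)
  show ?case by (rule orthogonal_at_down[of \<alpha>, OF a finite_bs_measure sets_bs_measure step.IH])
qed

lemma real_distribution_bs_measure: "real_distribution (bs_measure \<alpha> n)"
proof -
  interpret finite_measure "bs_measure \<alpha> n" by (rule finite_bs_measure)
  have "complex_of_real (measure (bs_measure \<alpha> n) (space (bs_measure \<alpha> n))) = 1"
    using bs_measure_orthogonal[of 0 n] by (simp add: orthogonal_at_def rho_sq_def scaleR_conv_of_real)
  then have "emeasure (bs_measure \<alpha> n) (space (bs_measure \<alpha> n)) = 1"
    by (simp add: emeasure_eq_measure)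
  then have "prob_space (bs_measure \<alpha> n)" by (rule prob_spaceI)
  then show ?thesis by (simp add: real_distribution_def real_distribution_axioms_def)
qed

lemma tight_bs_measure: "tight (bs_measure \<alpha>)"
  unfolding tight_def
proof (intro conjI allI impI)
  fix \<epsilon> :: real assume "0 < \<epsilon>"
  have "1 - \<epsilon> < measure (bs_measure \<alpha> n) {-1<..1}" for n
  proof -
    interpret real_distribution "bs_measure \<alpha> n" by (rule real_distribution_bs_measure)
    have "t \<in> {-1<..1}" if "0 < ennreal (indicator {0..1} t * bs_weight \<alpha> n t)" for t
      using that by (cases "t \<in> {0..1}") simp_all
    moreover have "(\<lambda>t. ennreal (indicator {0..1} t * bs_weight \<alpha> n t)) \<in> borel_measurable lborel"
      using bs_density_measurable[of n] by measurable
    ultimately have "AE t in bs_measure \<alpha> n. t \<in> {-1<..1}"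
      unfolding bs_measure_def by (intro iffD2[OF AE_density] AE_I2 impI)
    then have "prob {-1<..1} = 1" by (subst prob_eq_1) simp_all
    then show ?thesis using \<open>0 < \<epsilon>\<close> by simp
  qed
  then show "\<exists>a b. a < b \<and> (\<forall>n. 1 - \<epsilon> < measure (bs_measure \<alpha> n) {a<..b})"
    by (intro exI[of _ "-1"] exI[of _ 1]) simp
qed (rule real_distribution_bs_measure)

section \<open>Existence of a measure with prescribed Verblunsky coefficients\<close>

text \<open>For fixed \<open>k\<close> all but finitely many Bernstein-Szego measures are orthogonal at \<open>k\<close>, with the same
  integrals.  Hence so is every weak limit, because the integrands are bounded and continuous.\<close>

lemma exists_orthogonality_measure_line:
  obtains M where "real_distribution M" "\<And>k. orthogonal_at M \<alpha> k"
proof -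
  obtain r M where r: "strict_mono (r :: nat \<Rightarrow> nat)" and M: "real_distribution M"
    and wc: "weak_conv_m (bs_measure \<alpha> \<circ> id \<circ> r) M"
    using tight_imp_convergent_subsubsequence[OF tight_bs_measure strict_mono_id] by blast
  have "orthogonal_at M \<alpha> k" for k
    unfolding orthogonal_at_def
  proof (intro allI impI)
    fix m assume m: "m \<le> k"
    define f where "f z = cnj (z ^ m) * poly (Phi \<alpha> k) z" for z
    have f: "continuous_on UNIV f" unfolding f_def by (intro continuous_intros)
    obtain B where B: "\<And>t. norm (f (circ t)) \<le> B" using bounded_circ[OF f] by blast
    have "(\<lambda>n. LINT t|(bs_measure \<alpha> \<circ> id \<circ> r) n. f (circ t)) \<longlonglongrightarrow> (LINT t|M. f (circ t))"
    proof (rule weak_conv_imp_integral_bdd_continuous_conv[OF _ M wc])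
      show "isCont (\<lambda>t. f (circ t)) t" for t
        using f by (intro isCont_o2[OF isCont_circ]) (simp add: continuous_on_eq_continuous_at)
      show "norm (f (circ t)) \<le> B" for t by (rule B)
    qed (simp add: real_distribution_bs_measure)
    moreover have "\<forall>\<^sub>F n in sequentially. (LINT t|(bs_measure \<alpha> \<circ> id \<circ> r) n. f (circ t))
        = (if m = k then of_real (rho_sq \<alpha> k) else 0)"
    proof (rule eventually_sequentiallyI)
      fix n assume "n \<ge> k"
      then have "k \<le> r n" using seq_suble[OF r, of n] by simp
      then show "(LINT t|(bs_measure \<alpha> \<circ> id \<circ> r) n. f (circ t))
        = (if m = k then of_real (rho_sq \<alpha> k) else 0)"
        using bs_measure_orthogonal[of k "r n"] m by (simp add: orthogonal_at_def f_def)
    qed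
    ultimately have "(LINT t|M. f (circ t)) = (if m = k then of_real (rho_sq \<alpha> k) else 0)"
      by (rule LIMSEQ_unique[OF _ tendsto_eventually])
    then show "(LINT t|M. cnj (circ t ^ m) * poly (Phi \<alpha> k) (circ t)) = (if m = k then of_real (rho_sq \<alpha> k) else 0)"
      by (simp add: f_def)
  qed
  with M that show ?thesis by blast
qed

end

text \<open>The complement of the support is a union of open null sets; the Lindelof property makes it a
  countable one.\<close>

lemma AE_in_msupport:
  assumes "circle_prob \<mu>"
  shows "AE z in \<mu>. z \<in> msupport \<mu>"
proof -
  have sets: "sets \<mu> = sets (restrict_space borel unit_circle)"
    using assms by (simp add: circle_prob_def)
  have space: "space \<mu> = unit_circle"
    using sets_eq_imp_space_eq[OF sets] by (simp add: space_restrict_space)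
  define \<F> where "\<F> = {U. open U \<and> emeasure \<mu> (U \<inter> unit_circle) = 0}"
  obtain \<G> where \<G>: "\<G> \<subseteq> \<F>" "countable \<G>" "\<Union>\<G> = \<Union>\<F>"
    using Lindelof[of \<F>] by (auto simp: \<F>_def)
  have "AE z in \<mu>. z \<notin> U \<inter> unit_circle" if "U \<in> \<G>" for U
  proof -
    from that \<G> have U: "open U" "emeasure \<mu> (U \<inter> unit_circle) = 0" by (auto simp: \<F>_def)
    have "U \<inter> unit_circle \<in> sets \<mu>"
      unfolding sets using U(1) by (auto simp: sets_restrict_space)
    with U(2) have "U \<inter> unit_circle \<in> null_sets \<mu>" by auto
    then show ?thesis by (rule AE_not_in)
  qed
  then have "AE z in \<mu>. \<forall>U\<in>\<G>. z \<notin> U \<inter> unit_circle"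
    using \<G>(2) by (intro AE_ball_countable')
  then show ?thesis
  proof (rule AE_mp, intro AE_I2 impI)
    fix z assume "z \<in> space \<mu>" and z: "\<forall>U\<in>\<G>. z \<notin> U \<inter> unit_circle"
    then have circle: "z \<in> unit_circle" by (simp add: space)
    with z \<G>(3) have "z \<notin> \<Union>\<F>" by blast
    with circle show "z \<in> msupport \<mu>" by (auto simp: msupport_def \<F>_def zero_less_iff_neq_zero)
  qed
qed

text \<open>If the support were finite, the monic polynomial vanishing on it, of degree \<open>k\<close> say, would be zero
  almost everywhere; but its pairing with \<open>\<Phi>\<^sub>k\<close> is the product of the numbers \<open>1 - \<bar>\<alpha> j\<bar>\<^sup>2\<close> with
  \<open>j < k\<close>.\<close>

theorem Verblunsky_existence:
  assumes a: "\<And>n. cmod (\<alpha> n) < 1"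
  shows "\<exists>\<mu>. verblunsky_coeffs \<mu> \<alpha>"
proof -
  obtain M where M: "real_distribution M" and orth: "\<And>k. orthogonal_at M \<alpha> k"
    using exists_orthogonality_measure_line[of \<alpha>, OF a] by blast
  interpret M: real_distribution M by fact
  define \<mu> where "\<mu> = distr M (restrict_space borel unit_circle) circ"
  have meas: "circ \<in> measurable M (restrict_space borel unit_circle)"
    by (intro measurable_restrict_space2) (auto simp: unit_circle_def)
  have circle: "circle_prob \<mu>"
    using M.prob_space_distr[OF meas] by (simp add: circle_prob_def \<mu>_def)
  interpret prob_space \<mu> using circle by (simp add: circle_prob_def)
  have borel: "f \<in> borel_measurable (restrict_space borel unit_circle)" if "continuous_on UNIV f"
    for f :: "complex \<Rightarrow> complex"
    by (intro measurable_restrict_space1 borel_measurable_continuous_onI that)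
  have int: "(LINT z|\<mu>. f z) = (LINT t|M. f (circ t))" if "continuous_on UNIV f"
    for f :: "complex \<Rightarrow> complex"
    unfolding \<mu>_def by (intro integral_distr meas borel that)
  have intgrbl: "integrable \<mu> f" if "continuous_on UNIV f" for f :: "complex \<Rightarrow> complex"
    unfolding \<mu>_def
    using integrable_circ[OF M.finite_measure_axioms M.events_eq_borel that]
    by (subst integrable_distr_eq[OF meas borel[OF that]])
  have moments: "(LINT z|\<mu>. cnj (z ^ m) * poly (Phi \<alpha> k) z) = (if m = k then of_real (rho_sq \<alpha> k) else 0)"
    if "m \<le> k" for m k
    using orth[of k] that by (subst int) (auto simp: orthogonal_at_def intro!: continuous_intros)
  have "infinite (msupport \<mu>)"
  proof
    assume fin: "finite (msupport \<mu>)"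
    define q where "q = (\<Prod>s\<in>msupport \<mu>. [:- s, 1:])"
    define k where "k = degree q"
    have lead: "coeff q k = 1"
      using lead_coeff_prod[of "\<lambda>s. [:- s, 1:]" "msupport \<mu>"] by (simp add: q_def k_def)
    have "AE z in \<mu>. cnj (poly q z) * poly (Phi \<alpha> k) z = 0"
      using AE_in_msupport[OF circle] by (rule eventually_mono) (use fin in \<open>auto simp: q_def poly_prod\<close>)
    then have "(LINT z|\<mu>. cnj (poly q z) * poly (Phi \<alpha> k) z) = 0"
      by (intro integral_eq_zero_AE)
    moreover have "(LINT z|\<mu>. cnj (poly q z) * poly (Phi \<alpha> k) z)
        = (LINT z|\<mu>. (\<Sum>m\<le>k. cnj (coeff q m) * (cnj (z ^ m) * poly (Phi \<alpha> k) z)))"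
      by (simp add: poly_altdef k_def sum_distrib_right mult.assoc)
    moreover have "\<dots> = (\<Sum>m\<le>k. cnj (coeff q m) * (LINT z|\<mu>. cnj (z ^ m) * poly (Phi \<alpha> k) z))"
      by (subst Bochner_Integration.integral_sum) (auto intro!: intgrbl continuous_intros)
    moreover have "\<dots> = (\<Sum>m\<le>k. if m = k then of_real (rho_sq \<alpha> k) else 0)"
      using moments by (intro sum.cong) (auto simp: lead)
    ultimately show False using rho_sq_pos[of \<alpha> k, OF a] by simp
  qed
  moreover have "monic_orthogonal \<mu> n (Phi \<alpha> n)" for n
    using moments[of _ n] by (simp add: monic_orthogonal_def degree_Phi coeff_Phi_self)
  ultimately show ?thesis using circle a by (auto simp: verblunsky_coeffs_def)
qed

section \<open>A closed gap that is a singular point\<close>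

text \<open>The signs are arranged as \<open>+ - - +\<close>: the first two steps cancel at \<open>z = 1\<close>, and so do the last
  two.  The value \<open>3/5\<close> makes \<open>sqrt (1 - \<bar>\<alpha> j\<bar>\<^sup>2)\<close> rational.\<close>

definition sing_alpha :: "nat \<Rightarrow> complex" where
  "sing_alpha n = (if n mod 4 \<in> {0, 3} then 3 / 5 else - 3 / 5)"

lemma sing_alpha_simps: "sing_alpha 0 = 3/5" "sing_alpha (Suc 0) = -3/5" "sing_alpha (Suc (Suc 0)) = -3/5" "sing_alpha (Suc (Suc (Suc 0))) = 3/5"
  by (simp_all add: sing_alpha_def)

lemma rho_prod_sing_alpha: "rho_prod sing_alpha 4 = 256 / 625"
proof -
  have "sqrt (1 - (cmod (sing_alpha j))\<^sup>2) = 4 / 5" for j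
    by (rule real_sqrt_unique) (auto simp: sing_alpha_def power2_eq_square norm_divide)
  then have "rho_prod sing_alpha 4 = (\<Prod>j<(4::nat). 4 / 5)"
    unfolding rho_prod_def by (intro prod.cong refl)
  then show ?thesis by (simp add: power_divide)
qed

text \<open>Together with the next lemma, a way to compute reversals of explicit coefficient lists by
  rewriting.\<close>

lemma rev_poly_pCons: "rev_poly (Suc n) (pCons a q) = monom (cnj a) (Suc n) + rev_poly n q"
  by (rule poly_eqI) (auto simp: coeff_rev_poly Suc_diff_le split: nat.splits)

lemma rev_poly_0: "rev_poly 0 q = [:cnj (coeff q 0):]"
  by (simp add: rev_poly_def monom_0)

lemma four_Suc: "(4::nat) = Suc (Suc (Suc (Suc 0)))" by simp

lemma Phi_sing_alpha: "Phi sing_alpha 4 = [:-3/5, 24/25, 6/625, -24/25, 1:]"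
  by (simp add: four_Suc rev_poly_pCons rev_poly_0 monom_Suc monom_0 one_pCons sing_alpha_simps)

lemma Psi_sing_alpha: "Psi sing_alpha 4 = [:3/5, -6/25, -744/625, 6/25, 1:]"
  by (simp add: Psi_def four_Suc rev_poly_pCons rev_poly_0 monom_Suc monom_0 one_pCons sing_alpha_simps)

lemma phi_sing_alpha: "phi sing_alpha 4 = smult (1/256) [:-375, 600, 6, -600, 625:]"
  by (simp add: phi_def Phi_sing_alpha rho_prod_sing_alpha)

lemma psi_sing_alpha: "psi sing_alpha 4 = smult (1/256) [:375, -150, -744, 150, 625:]"
  by (simp add: psi_def Psi_sing_alpha rho_prod_sing_alpha)

lemma phi_star_sing_alpha: "phi_star sing_alpha 4 = smult (1/256) [:625, -600, 6, 600, -375:]"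
  unfolding phi_star_def phi_sing_alpha by (simp add: four_Suc rev_poly_pCons rev_poly_0 monom_Suc monom_0)

lemma psi_star_sing_alpha: "psi_star sing_alpha 4 = smult (1/256) [:625, 150, -744, -150, 375:]"
  unfolding psi_star_def psi_sing_alpha by (simp add: four_Suc rev_poly_pCons rev_poly_0 monom_Suc monom_0)

lemmas szego_sing_alpha = phi_sing_alpha psi_sing_alpha phi_star_sing_alpha psi_star_sing_alpha

lemma Discr_sing_alpha:
  "z \<noteq> 0 \<Longrightarrow> Discr sing_alpha 4 z = (625 * z ^ 4 - 738 * z\<^sup>2 + 625) / (256 * z\<^sup>2)"
  by (simp add: Discr_def szego_sing_alpha divide_simps) algebra

lemma eta_sing_alpha: "eta sing_alpha 4 z 1 = (-2000 + 1200 * z + 1488 * z\<^sup>2 - 1200 * z ^ 3) / 256"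
  by (simp add: eta_def szego_sing_alpha divide_simps) algebra

text \<open>The discriminant satisfies \<open>\<Delta> + 2 = delta_num / (256 z\<^sup>2)\<close> and \<open>\<Delta> - 2 = 625 (z\<^sup>2 - 1)\<^sup>2 / (256 z\<^sup>2)\<close>.  The
  double zero of the latter at \<open>1\<close> is the closed gap.  The function \<open>eta_quot\<close> is what remains of
  \<open>\<Delta> z\<^sup>2 + \<eta>\<close> after the factor \<open>z\<^sup>2 - 1\<close> is divided out (up to a constant).\<close>

definition delta_num :: "real \<Rightarrow> real" where "delta_num r = 625 * r ^ 4 - 226 * r\<^sup>2 + 625"
definition eta_quot :: "real \<Rightarrow> real" where "eta_quot r = 25 * r\<^sup>2 - 48 * r + 55"

lemma delta_num_pos: "0 < delta_num r"
proof -
  have "delta_num r = 625 * (r\<^sup>2 - 1)\<^sup>2 + 1024 * r\<^sup>2" by (simp add: delta_num_def) algebra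
  also have "\<dots> > 0" by (cases "r = 0") (auto intro: add_nonneg_pos)
  finally show ?thesis .
qed

text \<open>Because the zero of \<open>\<Delta> - 2\<close> is double, the square root is smooth in \<open>r\<close> up to the gap.\<close>

definition gap_sqrt :: "real \<Rightarrow> real" where "gap_sqrt r = 25 * (1 - r\<^sup>2) * sqrt (delta_num r) / (512 * r\<^sup>2)"

text \<open>On the radius \<open>\<Delta> > 2\<close>, so the two candidates for \<open>\<Gamma>\<^sub>+\<close> are positive reals with product one, and the
  positive root gives the larger.\<close>

lemma disc_sqrt_sing_alpha:
  assumes r: "0 < r" "r < 1"
  shows "disc_sqrt sing_alpha 4 (of_real r) = of_real (gap_sqrt r)"
proof -
  define d where "d = (625 * r ^ 4 - 738 * r\<^sup>2 + 625) / (256 * r\<^sup>2)"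
  have D: "Discr sing_alpha 4 (of_real r) = of_real d"
    using r by (simp add: Discr_sing_alpha d_def)
  have r2: "r\<^sup>2 < 1" using r by (simp add: power_less_one_iff)
  have S: "gap_sqrt r > 0" using r r2 delta_num_pos[of r] by (simp add: gap_sqrt_def)
  have "d - 2 = 625 * (r\<^sup>2 - 1)\<^sup>2 / (256 * r\<^sup>2)"
    using r by (simp add: d_def divide_simps) algebra
  also have "\<dots> > 0" using r r2 by simp
  finally have d: "d > 2" by simp
  have S2: "(gap_sqrt r)\<^sup>2 = d\<^sup>2 / 4 - 1"
  proof -
    have "(gap_sqrt r)\<^sup>2 = 625 * (1 - r\<^sup>2)\<^sup>2 * delta_num r / (512 * r\<^sup>2)\<^sup>2"
      using delta_num_pos[of r] unfolding gap_sqrt_def power_divide power_mult_distrib[of _ "sqrt (delta_num r)"]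
        power_mult_distrib[of 25] by simp
    also have "\<dots> = d\<^sup>2 / 4 - 1"
      using r by (simp add: d_def delta_num_def divide_simps) algebra
    finally show ?thesis .
  qed
  show ?thesis
    unfolding disc_sqrt_def D
  proof (rule the_equality, intro conjI)
    show "(complex_of_real (gap_sqrt r))\<^sup>2 = (of_real d)\<^sup>2 / 4 - 1"
      using arg_cong[OF S2, of complex_of_real] by simp
    show "1 < cmod (of_real d / 2 + of_real (gap_sqrt r))"
      using d S norm_of_real[of "d / 2 + gap_sqrt r", where 'a = complex] by simp
  next
    fix w :: complex assume w: "w\<^sup>2 = (of_real d)\<^sup>2 / 4 - 1 \<and> cmod (of_real d / 2 + w) > 1"
    then have "w\<^sup>2 = (of_real (gap_sqrt r))\<^sup>2"
      using arg_cong[OF S2, of complex_of_real] by simp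
    then consider "w = of_real (gap_sqrt r)" | "w = - of_real (gap_sqrt r)" by (auto simp: power2_eq_iff)
    then show "w = of_real (gap_sqrt r)"
    proof cases
      case 2
      have "(d / 2 - gap_sqrt r) * (d / 2 + gap_sqrt r) = 1" using S2 by (simp add: algebra_simps power2_eq_square)
      moreover have "d / 2 + gap_sqrt r > 1" using d S by simp
      ultimately have "0 < d / 2 - gap_sqrt r" "d / 2 - gap_sqrt r < 1"
        by (smt (verit) mult_le_0_iff mult_less_cancel_left1)+
      then have "cmod (of_real d / 2 + w) < 1"
        using norm_of_real[of "d / 2 - gap_sqrt r", where 'a = complex] 2 by simp
      with w show ?thesis by simp
    qed
  qed
qed

text \<open>The common factor \<open>1 - r\<^sup>2\<close> of numerator and square root cancels and leaves
  \<open>j\<^sub>0 = (q - eta_quot) / (2 q)\<close> with \<open>q = sqrt delta_num\<close>.  At \<open>r = 1\<close> both terms of the numerator equal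
  \<open>32\<close>; rationalising it exhibits the simple zero.\<close>

lemma jfun_sing_alpha:
  assumes r: "0 < r" "r < 1"
  shows "jfun sing_alpha 4 0 (of_real r)
     = of_real ((1 - r) * ((-1200 * r\<^sup>2 + 1440 * r - 1200) / (sqrt (delta_num r) * (sqrt (delta_num r) + eta_quot r))))"
proof -
  define q where "q = sqrt (delta_num r)"
  have q: "q > 0" "q\<^sup>2 = delta_num r" using delta_num_pos[of r] by (simp_all add: q_def)
  have "eta_quot r = 25 * (r - 24/25)\<^sup>2 + 799/25" by (simp add: eta_quot_def power2_eq_square algebra_simps)
  then have R: "eta_quot r > 0" by (simp add: add_nonneg_pos)
  have S: "gap_sqrt r = 25 * (1 - r\<^sup>2) * q / (512 * r\<^sup>2)" by (simp add: gap_sqrt_def q_def)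
  have r2: "r\<^sup>2 < 1" using r by (simp add: power_less_one_iff)
  have "jfun sing_alpha 4 0 (of_real r) = of_real
     (((625 * r ^ 4 - 738 * r\<^sup>2 + 625) / (256 * r\<^sup>2) / 2 + gap_sqrt r) / (2 * gap_sqrt r)
      + (-2000 + 1200 * r + 1488 * r\<^sup>2 - 1200 * r ^ 3) / 256 / (4 * r\<^sup>2 * gap_sqrt r))"
    using r by (simp add: jfun_0 j0_def Gamma_plus_def disc_sqrt_sing_alpha Discr_sing_alpha eta_sing_alpha)
  also have "((625 * r ^ 4 - 738 * r\<^sup>2 + 625) / (256 * r\<^sup>2) / 2 + gap_sqrt r) / (2 * gap_sqrt r)
      + (-2000 + 1200 * r + 1488 * r\<^sup>2 - 1200 * r ^ 3) / 256 / (4 * r\<^sup>2 * gap_sqrt r) = (q - eta_quot r) / (2 * q)"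
  proof -
    have s: "gap_sqrt r * (512 * r\<^sup>2) = 25 * (1 - r\<^sup>2) * q" using r by (simp add: S)
    have "gap_sqrt r > 0" using S q r r2 by simp
    \<comment> \<open>\<open>P\<close> is 256 times \<open>\<Delta> z\<^sup>2 + \<eta>\<close>.\<close>
    define P where "P = 625 * r ^ 4 - 1200 * r ^ 3 + 750 * r\<^sup>2 + 1200 * r - 1375"
    have "((625 * r ^ 4 - 738 * r\<^sup>2 + 625) / (256 * r\<^sup>2) / 2 + gap_sqrt r) / (2 * gap_sqrt r)
      + (-2000 + 1200 * r + 1488 * r\<^sup>2 - 1200 * r ^ 3) / 256 / (4 * r\<^sup>2 * gap_sqrt r)
      = 1 / 2 + P / (2 * (gap_sqrt r * (512 * r\<^sup>2)))"
      using \<open>gap_sqrt r > 0\<close> r by (simp add: P_def divide_simps)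
    also have "P = - (25 * (1 - r\<^sup>2)) * eta_quot r"
      by (simp add: P_def eta_quot_def) algebra
    also have "1 / 2 + - (25 * (1 - r\<^sup>2)) * eta_quot r / (2 * (gap_sqrt r * (512 * r\<^sup>2))) = (q - eta_quot r) / (2 * q)"
      unfolding s using q r2 by (simp add: divide_simps) (simp add: algebra_simps)
    finally show ?thesis .
  qed
  also have "\<dots> = (q\<^sup>2 - (eta_quot r)\<^sup>2) / (2 * (q * (q + eta_quot r)))"
    using q(1) R by (simp add: divide_simps) algebra
  also have "q\<^sup>2 - (eta_quot r)\<^sup>2 = 2 * ((1 - r) * (-1200 * r\<^sup>2 + 1440 * r - 1200))"
    unfolding q by (simp add: delta_num_def eta_quot_def) algebra
  finally show ?thesis by (simp add: q_def)
qed

lemma vanishes_sing_alpha: "vanishes_to_order (jfun sing_alpha 4 0) 1 1"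
  unfolding vanishes_to_order_def
proof (intro exI conjI)
  define g where "g r = (-1200 * r\<^sup>2 + 1440 * r - 1200) / (sqrt (delta_num r) * (sqrt (delta_num r) + eta_quot r))" for r
  have "isCont delta_num 1" "isCont eta_quot 1" unfolding delta_num_def[abs_def] eta_quot_def[abs_def] by (intro continuous_intros)+
  moreover have "delta_num 1 = 32\<^sup>2" "eta_quot 1 = 32" by (simp_all add: delta_num_def eta_quot_def)
  moreover from this have "sqrt (delta_num 1) = 32" by (simp only: real_sqrt_abs)
  ultimately have "isCont g 1" and g1: "g 1 = - 15 / 32"
    unfolding g_def[abs_def] by (auto intro!: continuous_intros)
  then have "(g \<longlongrightarrow> g 1) (at_left 1)"
    by (simp add: isCont_def filterlim_at_split)
  then have "((\<lambda>r. complex_of_real (g r)) \<longlongrightarrow> of_real (- 15 / 32)) (at_left 1)"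
    unfolding g1 by (intro tendsto_of_real)
  moreover have "\<forall>\<^sub>F r in at_left 1. complex_of_real (g r)
      = jfun sing_alpha 4 0 (complex_of_real r * 1) / complex_of_real ((1 - r) ^ 1)"
    using eventually_at_left_real[OF zero_less_one]
    by (rule eventually_mono) (auto simp: jfun_sing_alpha g_def)
  ultimately show "((\<lambda>r. jfun sing_alpha 4 0 (complex_of_real r * 1) / complex_of_real ((1 - r) ^ 1))
      \<longlongrightarrow> of_real (- 15 / 32)) (at_left 1)"
    by (rule Lim_transform_eventually)
qed simp

lemma one_in_band_sing_alpha: "\<exists>B\<in>bands sing_alpha 4. 1 \<in> B"
proof -
  have "1 \<in> {z \<in> unit_circle. cmod (Discr sing_alpha 4 z) \<le> 2}"
    by (simp add: unit_circle_def Discr_sing_alpha)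
  then show ?thesis
    by (metis Union_components UnionE bands_def)
qed

theorem mainTheorem2:
  shows "\<exists>(p::nat) (\<mu>::complex measure) (\<alpha>::nat \<Rightarrow> complex).
           even p \<and> 0 < p \<and>
           verblunsky_coeffs \<mu> \<alpha> \<and> (\<forall>n. \<alpha> (n + p) = \<alpha> n) \<and>
           (\<exists>(k::nat) (z::complex). k \<ge> 1 \<and> singular_point \<alpha> p k z)"
proof -
  have "cmod (sing_alpha n) < 1" for n
    by (simp add: sing_alpha_def norm_divide)
  then obtain \<mu> where "verblunsky_coeffs \<mu> sing_alpha"
    using Verblunsky_existence by blast
  moreover have "sing_alpha (n + 4) = sing_alpha n" for n
    by (simp add: sing_alpha_def)
  moreover have "singular_point sing_alpha 4 1 1"
    unfolding singular_point_def
    using one_in_band_sing_alpha vanishes_sing_alpha by (intro conjI exI[of _ 0]) simp_all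
  ultimately show ?thesis
    by (intro exI[of _ 4] exI[of _ \<mu>] exI[of _ sing_alpha] conjI exI[of _ "1::nat"] exI[of _ "1::complex"]) simp_all
qed

end
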